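(* Fix a unit $i$ and a period $t$, with real cost coefficients $a_i,b_i$ and generation limits $0\le \underline{P}_i\le \overline{P}_i$. Let $\boldsymbol{\lambda}_t=(\lambda_{0,t},(\lambda_{l,t}^+)_l,(\lambda_{l,t}^-)_l)$ be a given vector of multipliers with $\lambda_{0,t}\in\mathbb{R}$ and $\lambda_{l,t}^+,\lambda_{l,t}^-\ge 0$ for all $l$, and let $\beta_{i,t}(\boldsymbol{\lambda}_t)=-\lambda_{0,t}+\sum_l(\lambda_{l,t}^+-\lambda_{l,t}^-)\Gamma^U_{l,i}$. Let $L_{i,t}(\boldsymbol{\lambda}_t)$ denote the optimal objective value of the individual-unit subproblem $$\min_{p_{i,t},\,z_{i,t}}\; C_i(p_{i,t},z_{i,t})+\beta_{i,t}(\boldsymbol{\lambda}_t)\,p_{i,t}\quad\text{s.t.}\quad z_{i,t}\underline{P}_i\le p_{i,t}\le z_{i,t}\overline{P}_i,\quad z_{i,t}\in\{0,1\},$$ where $C_i(p,0)=0$ and $C_i(p,1)=a_ip+b_i$. Then $L_{i,t}(\boldsymbol{\lambda}_t)$ is a piecewise linear concave function of $\beta_{i,t}(\boldsymbol{\lambda}_t)$, given by $$L_{i,t}(\boldsymbol{\lambda}_t)=\min\bigl\{[a_i+\beta_{i,t}(\boldsymbol{\lambda}_t)]\overline{P}_i+b_i,\;[a_i+\beta_{i,t}(\boldsymbol{\lambda}_t)]\underline{P}_i+b_i,\;0\bigr\}.$$ Moreover, an optimal commitment decision $z_{i,t}$ of the subproblem is $$z_{i,t}(\boldsymbol{\lambda}_t)=\begin{cases}0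 & \text{if } L_{i,t}(\boldsymbol{\lambda}_t)=0,\\ 1 & \text{otherwise,}\end{cases}$$ i.e. there is an optimal solution $(p_{i,t},z_{i,t})$ of the subproblem with this value of $z_{i,t}$.
   Context: $i$ indexes finitely many generating units, $t$ is a time period, and $l$ indexes finitely many transmission constraints. $p_{i,t}\in\mathbb{R}$ is the dispatch and $z_{i,t}\in\{0,1\}$ the on/off commitment of unit $i$ at period $t$. $\underline{P}_i,\overline{P}_i$ are the minimum and maximum generation capacities of unit $i$. $\Gamma^U_{l,i}\in\mathbb{R}$ are given constants (power transfer distribution factors). *)

theory Defs
  imports "HOL-Analysis.Analysis"
begin

record ('i, 'l) power_system =
  gens :: "'i set"
  lines :: "'l set"
  cost_a :: "'i \<Rightarrow> real"
  cost_b :: "'i \<Rightarrow> real"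
  P_min :: "'i \<Rightarrow> real"
  P_max :: "'i \<Rightarrow> real"
  PTDF :: "'l \<Rightarrow> 'i \<Rightarrow> real"

text \<open>The multipliers of a single period.\<close>

record 'l multipliers =
  lam0 :: real
  lam_plus :: "'l \<Rightarrow> real"
  lam_minus :: "'l \<Rightarrow> real"

definition admissible :: "('i, 'l) power_system \<Rightarrow> 'l multipliers \<Rightarrow> bool" where
  "admissible S \<mu> \<longleftrightarrow> (\<forall>l\<in>lines S. 0 \<le> lam_plus \<mu> l \<and> 0 \<le> lam_minus \<mu> l)"

definition beta :: "('i, 'l) power_system \<Rightarrow> 'i \<Rightarrow> 'l multipliers \<Rightarrow> real" where
  "beta S i \<mu> = - lam0 \<mu> + (\<Sum>l\<in>lines S. (lam_plus \<mu> l - lam_minus \<mu> l) * PTDF S l i)"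

text \<open>The commitment \<open>z\<close> is a real number that feasibility restricts to 0 or 1; the cost at
  any other \<open>z\<close> is irrelevant.\<close>

definition gen_cost :: "('i, 'l) power_system \<Rightarrow> 'i \<Rightarrow> real \<Rightarrow> real \<Rightarrow> real" where
  "gen_cost S i p z = (if z = 1 then cost_a S i * p + cost_b S i else 0)"

definition feasible :: "('i, 'l) power_system \<Rightarrow> 'i \<Rightarrow> real \<times> real \<Rightarrow> bool" where
  "feasible S i = (\<lambda>(p, z). z * P_min S i \<le> p \<and> p \<le> z * P_max S i \<and> z \<in> {0, 1})"

definition objective ::
  "('i, 'l) power_system \<Rightarrow> 'i \<Rightarrow> 'l multipliers \<Rightarrow> real \<times> real \<Rightarrow> real" where
  "objective S i \<mu> = (\<lambda>(p, z). gen_cost S i p z + beta S i \<mu> * p)"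

definition optimal_value :: "('i, 'l) power_system \<Rightarrow> 'i \<Rightarrow> 'l multipliers \<Rightarrow> real" where
  "optimal_value S i \<mu> = (INF x\<in>{x. feasible S i x}. objective S i \<mu> x)"

text \<open>Continuous and affine on every interval that avoids a finite set of breakpoints.\<close>

definition piecewise_linear :: "(real \<Rightarrow> real) \<Rightarrow> bool" where
  "piecewise_linear f \<longleftrightarrow> continuous_on UNIV f \<and>
     (\<exists>B. finite B \<and>
       (\<forall>J. is_interval J \<and> J \<inter> B = {} \<longrightarrow> (\<exists>m c. \<forall>x\<in>J. f x = m * x + c)))"

end

theory Submission
  imports Defs
begin

text \<open>The feasible set is the single point (0, 0), of cost 0, together with the dispatch
  interval at \<open>z = 1\<close>. There the cost is affine in \<open>p\<close>, so it is least at
  an endpoint; hence the three-term minimum (\<open>subproblem_solution\<close>). For fixed unit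
  data each term is affine in \<open>beta\<close>, with the dispatch level as slope. The value is
  thus a minimum of finitely many affine functions, which is concave and piecewise linear
  (\<open>concave_on_min_affine\<close>, \<open>piecewise_linear_min_affine\<close>).\<close>

definition min_affine :: "(real \<times> real) set \<Rightarrow> real \<Rightarrow> real" where
  "min_affine K x = Min ((\<lambda>(m, c). m * x + c) ` K)"

lemma min_affine_le:
  assumes "finite K" "(m, c) \<in> K"
  shows "min_affine K x \<le> m * x + c"
  unfolding min_affine_def using assms by (force intro: Min_le)

lemma min_affine_attained:
  assumes "finite K" "K \<noteq> {}"
  obtains m c where "(m, c) \<in> K" "min_affine K x = m * x + c"
proof -
  have "min_affine K x \<in> (\<lambda>(m, c). m * x + c) ` K"
    unfolding min_affine_def using assms by (intro Min_in) auto
  then show ?thesis using that by auto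
qed

text \<open>The line attaining the minimum at the convex combination bounds the minimum from above
  at both end points.\<close>

lemma concave_on_min_affine:
  assumes "finite K" "K \<noteq> {}"
  shows "concave_on UNIV (min_affine K)"
  unfolding concave_on_iff
proof (intro conjI ballI allI impI convex_UNIV)
  fix x y u v :: real
  assume uv: "0 \<le> u" "0 \<le> v" "u + v = 1"
  obtain m c where mc: "(m, c) \<in> K"
    and eq: "min_affine K (u *\<^sub>R x + v *\<^sub>R y) = m * (u *\<^sub>R x + v *\<^sub>R y) + c"
    using min_affine_attained[OF assms] .
  have "u * min_affine K x + v * min_affine K y \<le> u * (m * x + c) + v * (m * y + c)"
    using uv by (intro add_mono mult_left_mono min_affine_le assms mc)
  also have "\<dots> = m * (u *\<^sub>R x + v *\<^sub>R y) + (u + v) * c"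
    by (simp add: algebra_simps)
  finally show "u * min_affine K x + v * min_affine K y \<le> min_affine K (u *\<^sub>R x + v *\<^sub>R y)"
    using uv eq by simp
qed

lemma piecewise_linear_min_affine:
  assumes "finite K" "K \<noteq> {}"
  shows "piecewise_linear (min_affine K)"
proof -
  txt \<open>The breakpoints are the crossings of two lines: on an interval without crossings, the line
    that is lowest at one point stays lowest.\<close>
  define B where "B = (\<lambda>((m, c), (m', c')). (c' - c) / (m - m')) ` (K \<times> K)"
  have "\<exists>m c. \<forall>x\<in>J. min_affine K x = m * x + c" if J: "is_interval J" "J \<inter> B = {}" for J
  proof (cases "J = {}")
    case False
    then obtain x0 where x0: "x0 \<in> J" by blast
    obtain m c where mc: "(m, c) \<in> K" and min0: "min_affine K x0 = m * x0 + c"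
      using min_affine_attained[OF assms] .
    have "min_affine K x = m * x + c" if "x \<in> J" for x
    proof (rule ccontr)
      assume "min_affine K x \<noteq> m * x + c"
      then have lt: "min_affine K x < m * x + c"
        using min_affine_le[OF assms(1) mc, of x] by linarith
      obtain m' c' where mc': "(m', c') \<in> K" and minx: "min_affine K x = m' * x + c'"
        using min_affine_attained[OF assms] .
      \<comment> \<open>The gap between the line lowest at \<open>x0\<close> and the line lowest at
        \<open>x\<close> changes sign on \<open>J\<close>, so it vanishes somewhere in
        \<open>J\<close> by the intermediate value theorem.\<close>
      let ?d = "\<lambda>y. (m - m') * y + (c - c')"
      have d: "?d x0 \<le> 0" "0 \<le> ?d x"
        using min0 min_affine_le[OF assms(1) mc', of x0] lt minx by (auto simp: algebra_simps)
      have "connected (?d ` J)"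
        using J(1) by (intro connected_continuous_image continuous_intros is_interval_connected)
      then have "0 \<in> ?d ` J"
        using connectedD_interval[of "?d ` J" "?d x0" "?d x" 0] d x0 \<open>x \<in> J\<close> by blast
      then obtain y where y: "y \<in> J" "?d y = 0" by auto
      \<comment> \<open>For parallel lines \<open>?d\<close> would be constant, yet it is 0 at
        \<open>y\<close> and positive at \<open>x\<close>. So the quotient in \<open>B\<close> is a
        genuine crossing, not a division by 0.\<close>
      have "m \<noteq> m'" using d lt minx y by auto
      then have "y = (c' - c) / (m - m')"
        using y(2) by (simp add: field_simps)
      then have "y \<in> B" using mc mc' unfolding B_def by force
      then show False using y(1) J(2) by blast
    qed
    then show ?thesis by blast
  qed simp
  moreover have "finite B" unfolding B_def using assms(1) by simp
  \<comment> \<open>A convex function on an open set is continuous; this is applied to the negated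
    minimum.\<close>
  moreover have "continuous_on UNIV (min_affine K)"
    using concave_on_min_affine[OF assms] convex_on_continuous[OF open_UNIV, of "\<lambda>x. - min_affine K x"]
      continuous_on_minus[of UNIV "\<lambda>x. - min_affine K x"]
    by (simp add: concave_on_def)
  ultimately show ?thesis unfolding piecewise_linear_def by blast
qed

text \<open>The sign of the slope decides which endpoint is lowest.\<close>

lemma affine_ge_min_endpoints:
  fixes p :: real
  assumes "l \<le> p" "p \<le> u"
  shows "min (m * u + c) (m * l + c) \<le> m * p + c"
proof (cases "0 \<le> m")
  case True
  then show ?thesis using mult_left_mono[OF assms(1), of m] by linarith
next
  case False
  then show ?thesis using mult_left_mono_neg[OF assms(2), of m] by linarith
qed

lemma optimal_value_eq_objective:
  assumes "is_arg_min (objective S i \<mu>) (feasible S i) x"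
  shows "optimal_value S i \<mu> = objective S i \<mu> x"
  unfolding optimal_value_def
  using assms by (intro cInf_eq_minimum) (auto simp: is_arg_min_linorder)

text \<open>\<open>L \<mu>\<close> bounds the objective from below on the feasible set, and one
  feasible point with the prescribed commitment attains it; that point yields both
  conclusions.\<close>

lemma subproblem_solution:
  fixes S :: "('i, 'l) power_system"
  assumes "P_min S i \<le> P_max S i"
  defines "L \<equiv> \<lambda>\<mu>. Min {(cost_a S i + beta S i \<mu>) * P_max S i + cost_b S i,
                (cost_a S i + beta S i \<mu>) * P_min S i + cost_b S i, 0}"
  shows "optimal_value S i \<mu> = L \<mu>"
    and "\<exists>p. is_arg_min (objective S i \<mu>) (feasible S i) (p, if L \<mu> = 0 then 0 else 1)"
proof -
  let ?m = "cost_a S i + beta S i \<mu>"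
  have on: "objective S i \<mu> (p, 1) = ?m * p + cost_b S i" for p
    by (simp add: objective_def gen_cost_def algebra_simps)
  have off: "objective S i \<mu> (0, 0) = 0"
    by (simp add: objective_def gen_cost_def)
  have lower: "L \<mu> \<le> objective S i \<mu> x" if feas: "feasible S i x" for x
  proof -
    obtain p z where x: "x = (p, z)" by fastforce
    consider "z = 0" "p = 0" | "z = 1" "P_min S i \<le> p" "p \<le> P_max S i"
      using feas x by (auto simp: feasible_def)
    then show ?thesis
    proof cases
      case 1
      then show ?thesis using x off by (simp add: L_def)
    next
      case 2
      then show ?thesis
        using x on affine_ge_min_endpoints[of "P_min S i" p "P_max S i" ?m "cost_b S i"]
        by (auto simp: L_def min_def split: if_splits)
    qed
  qed
  \<comment> \<open>If the minimum is 0, being off attains it, even in a tie; otherwise an endpoint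
    term is the minimum, and running at that capacity attains it.\<close>
  obtain x where x: "feasible S i x" "objective S i \<mu> x = L \<mu>" "snd x = (if L \<mu> = 0 then 0 else 1)"
  proof (cases "L \<mu> = 0")
    case True
    then show ?thesis using that[of "(0, 0)"] off by (auto simp: feasible_def)
  next
    case False
    then obtain p where "p \<in> {P_min S i, P_max S i}" "L \<mu> = ?m * p + cost_b S i"
      by (auto simp: L_def min_def split: if_splits)
    then show ?thesis
      using that[of "(p, 1)"] on[of p] False assms(1) by (auto simp: feasible_def)
  qed
  have arg_min: "is_arg_min (objective S i \<mu>) (feasible S i) x"
    using x lower by (simp add: is_arg_min_linorder)
  show "optimal_value S i \<mu> = L \<mu>"
    using optimal_value_eq_objective[OF arg_min] x(2) by simp
  show "\<exists>p. is_arg_min (objective S i \<mu>) (feasible S i) (p, if L \<mu> = 0 then 0 else 1)"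
    using arg_min x(3) by (metis prod.collapse)
qed

theorem theorem1:
  fixes S :: "('i, 'l) power_system"
    and i :: 'i and t :: 't
    and lam :: "'t \<Rightarrow> 'l multipliers"
  assumes "finite (gens S)" and "finite (lines S)"
    and "i \<in> gens S"
    and "0 \<le> P_min S i" and "P_min S i \<le> P_max S i"
    and "admissible S (lam t)"
  shows "(\<exists>\<phi>. concave_on UNIV \<phi> \<and> piecewise_linear \<phi> \<and>
            (\<forall>\<mu>. admissible S \<mu> \<longrightarrow> optimal_value S i \<mu> = \<phi> (beta S i \<mu>))) \<and>
         optimal_value S i (lam t) =
           Min {(cost_a S i + beta S i (lam t)) * P_max S i + cost_b S i,
                (cost_a S i + beta S i (lam t)) * P_min S i + cost_b S i,
                0} \<and>
         (\<exists>p. is_arg_min (objective S i (lam t)) (feasible S i)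
           (p, if optimal_value S i (lam t) = 0 then 0 else 1))"
proof -
  \<comment> \<open>The three terms regrouped as lines in \<open>beta\<close>. The set depends on
    the unit data only, so one function serves all multipliers.\<close>
  define K where "K = {(P_max S i, cost_a S i * P_max S i + cost_b S i),
    (P_min S i, cost_a S i * P_min S i + cost_b S i), (0, 0)}"
  have K: "finite K" "K \<noteq> {}" by (simp_all add: K_def)
  have "optimal_value S i \<mu> = min_affine K (beta S i \<mu>)" for \<mu>
    unfolding subproblem_solution(1)[OF assms(5)] min_affine_def K_def
    by (simp add: algebra_simps)
  then have "\<exists>\<phi>. concave_on UNIV \<phi> \<and> piecewise_linear \<phi> \<and>
      (\<forall>\<mu>. admissible S \<mu> \<longrightarrow> optimal_value S i \<mu> = \<phi> (beta S i \<mu>))"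
    using concave_on_min_affine[OF K] piecewise_linear_min_affine[OF K] by blast
  then show ?thesis
    using subproblem_solution[OF assms(5)] by simp
qed

end
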